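(* Let $\varphi\in C^2(\mathbb R)$ with $\varphi'(v)\ge c>0$ for all $v\in\mathbb R$, and let $\xi\in C^\infty(\mathbb T)$. (1) Assume $\chi\in C^1(\mathbb R)$ satisfies $|\chi'(v)|\le C\varphi'(v)$, $v\in\mathbb R$, for some $C>0$. Then, for two solutions $v_1,v_2$ of $$\partial_tv=\Delta\{\varphi(v)\}+\nabla\{\chi(v)\xi\}\quad\text{on }\mathbb T,$$ if $v_1(0)\ge v_2(0)$, then $v_1(t)\ge v_2(t)$ for all $t\ge0$. (2) In addition, assume $\chi(0)=0$. Then, for a solution $v$ of the same equation, if $v(0)\ge0$, then $v(t)\ge0$ for all $t\ge0$.
   Context: $\mathbb T=\mathbb R/\mathbb Z$, $\nabla=\partial_x$, $\Delta=\partial_x^2$. Solutions are functions $v=v(t,x)$, $t\ge0$, $x\in\mathbb T$, understood as classical (smooth) solutions. $v_1\ge v_2$ means $v_1(x)\ge v_2(x)$ for all $x\in\mathbb T$. *)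

theory Defs
  imports "HOL-Analysis.Analysis" "HOL-Library.Periodic_Fun"
begin

text \<open>Functions on the torus \<open>\<real>/\<int>\<close> are represented by \<open>1\<close>-periodic functions on \<open>\<real>\<close>
  (\<^const>\<open>periodic_fun_simple'\<close> says \<open>f (x + 1) = f x\<close> for all \<open>x\<close>).\<close>

definition C_k :: "nat \<Rightarrow> (real \<Rightarrow> real) \<Rightarrow> bool" where
  "C_k k f \<longleftrightarrow>
     (\<forall>j<k. \<forall>x. (deriv ^^ j) f field_differentiable at x) \<and> continuous_on UNIV ((deriv ^^ k) f)"

definition smooth_torus :: "(real \<Rightarrow> real) \<Rightarrow> bool" where
  "smooth_torus f \<longleftrightarrow> periodic_fun_simple' f \<and> (\<forall>k. C_k k f)"

definition d_t :: "(real \<Rightarrow> real \<Rightarrow> real) \<Rightarrow> real \<Rightarrow> real \<Rightarrow> real" where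
  "d_t v t x = deriv (\<lambda>s. v s x) t"

definition grad :: "(real \<Rightarrow> real) \<Rightarrow> real \<Rightarrow> real" where
  "grad f = deriv f"

definition laplace :: "(real \<Rightarrow> real) \<Rightarrow> real \<Rightarrow> real" where
  "laplace f = deriv (deriv f)"

text \<open>The regularity of a classical solution of a second-order parabolic equation: continuous on
  \<open>[0,\<infinity>) \<times> \<real>/\<int>\<close> and of class \<open>C\<^sup>1\<close> in time, \<open>C\<^sup>2\<close> in space on \<open>(0,\<infinity>) \<times> \<real>/\<int>\<close>. More cannot be
  expected when the coefficients are only \<open>C\<^sup>2\<close> and \<open>C\<^sup>1\<close>; solutions that are smooth up to \<open>t = 0\<close>
  are included. Values at negative times are irrelevant.\<close>

definition classical_regularity :: "(real \<Rightarrow> real \<Rightarrow> real) \<Rightarrow> bool" where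
  "classical_regularity v \<longleftrightarrow>
     (\<forall>t\<ge>0. periodic_fun_simple' (v t)) \<and>
     continuous_on ({0..} \<times> UNIV) (\<lambda>(t, x). v t x) \<and>
     (\<forall>t>0. \<forall>x. (\<lambda>s. v s x) field_differentiable at t) \<and>
     (\<forall>t>0. \<forall>x. v t field_differentiable at x) \<and>
     (\<forall>t>0. \<forall>x. grad (v t) field_differentiable at x) \<and>
     continuous_on ({0<..} \<times> UNIV) (\<lambda>(t, x). d_t v t x) \<and>
     continuous_on ({0<..} \<times> UNIV) (\<lambda>(t, x). grad (v t) x) \<and>
     continuous_on ({0<..} \<times> UNIV) (\<lambda>(t, x). laplace (v t) x)"

text \<open>For \<open>\<phi> \<in> C\<^sup>2\<close>, \<open>chi \<in> C\<^sup>1\<close> and \<open>\<xi> \<in> C\<^sup>1\<close> the regularity of \<open>v\<close> makes all derivatives on the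
  right-hand side exist.\<close>

definition is_solution ::
  "(real \<Rightarrow> real) \<Rightarrow> (real \<Rightarrow> real) \<Rightarrow> (real \<Rightarrow> real) \<Rightarrow> (real \<Rightarrow> real \<Rightarrow> real) \<Rightarrow> bool" where
  "is_solution \<phi> chi \<xi> v \<longleftrightarrow>
     classical_regularity v \<and>
     (\<forall>t>0. \<forall>x. d_t v t x =
        laplace (\<lambda>y. \<phi> (v t y)) x + grad (\<lambda>y. chi (v t y) * \<xi> y) x)"

end

theory Submission
  imports Defs
begin

text \<open>
  The equation has the form \<open>\<partial>\<^sub>t v = \<partial>\<^sub>x F\<close> with flux \<open>F = \<phi>'(v) \<partial>\<^sub>x v + chi(v) \<xi>\<close>, and comparison is a
  consequence of its \<open>L\<^sup>1\<close>-contraction: for \<open>w = v\<^sub>2 - v\<^sub>1\<close> the integral of the positive part of \<open>w\<close>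
  over one period does not increase in time. If \<open>w \<le> 0\<close> initially, it vanishes forever.

  A pointwise maximum principle for \<open>w\<close> is not available, because expanding the equation brings in
  differences of \<open>\<phi>''\<close> and of \<open>chi'\<close>, which are merely continuous. In divergence form only
  differences of \<open>\<phi>'\<close> and \<open>chi\<close> occur, and these are locally Lipschitz. The flux difference \<open>G\<close> is
  therefore \<open>\<phi>'(v\<^sub>2) \<partial>\<^sub>x w\<close> up to an error at most \<open>L \<bar>w\<bar>\<close> (\<open>flux_difference_bound\<close>).

  Let \<open>J\<^sub>\<epsilon>\<close> be a smooth convex approximation of the positive part. Integration by parts over one period
  turns the time derivative of \<open>\<integral> J\<^sub>\<epsilon>(w)\<close> into \<open>- \<integral> J\<^sub>\<epsilon>''(w) \<partial>\<^sub>x w G\<close>. The ellipticity \<open>\<phi>' \<ge> c\<close> absorbs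
  the error by completing the square, leaving at most \<open>L\<^sup>2/(4c) \<integral> w\<^sup>2 J\<^sub>\<epsilon>''(w)\<close>. Since \<open>J\<^sub>\<epsilon>''\<close> is of size
  \<open>1/\<epsilon>\<close> and concentrated where \<open>\<bar>w\<bar> \<lesssim> \<epsilon>\<close>, this is \<open>O(\<epsilon>)\<close>
  (\<open>integral_smooth_pos'_flux_le\<close>), and \<open>\<epsilon> \<rightarrow> 0\<close> gives the contraction.

  The constant \<open>L\<close> involves \<open>\<partial>\<^sub>x v\<^sub>1\<close>, which may blow up as \<open>t \<rightarrow> 0\<close>. The contraction is hence first
  proved between two positive times, with a constant that is harmless because it disappears with \<open>\<epsilon>\<close>;
  then the earlier time tends to \<open>0\<close>, where only continuity of the solutions is needed. In
  an \<open>L\<^sup>2\<close> estimate with Gronwall's inequality the constant would stay, and its behaviour as \<open>t \<rightarrow> 0\<close>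
  would matter.

  Nonnegativity is the case \<open>v\<^sub>2 = 0\<close>, which is a solution when \<open>chi(0) = 0\<close>.
\<close>

section \<open>A smooth approximation of the positive part\<close>

text \<open>For \<open>\<epsilon> > 0\<close> this choice of \<open>J\<^sub>\<epsilon>\<close> is smooth on all of \<open>\<real>\<close>, so that it needs no case distinction at \<open>0\<close>, and lies
  within \<open>\<epsilon>/2\<close> above the positive part.\<close>

definition smooth_pos :: "real \<Rightarrow> real \<Rightarrow> real" where
  "smooth_pos e s = (s + sqrt (s\<^sup>2 + e\<^sup>2)) / 2"

definition smooth_pos' :: "real \<Rightarrow> real \<Rightarrow> real" where
  "smooth_pos' e s = (1 + s / sqrt (s\<^sup>2 + e\<^sup>2)) / 2"

definition smooth_pos'' :: "real \<Rightarrow> real \<Rightarrow> real" where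
  "smooth_pos'' e s = e\<^sup>2 / (2 * sqrt (s\<^sup>2 + e\<^sup>2) ^ 3)"

lemma smooth_pos_ge: "max 0 s \<le> smooth_pos e s"
proof -
  have "\<bar>s\<bar> \<le> sqrt (s\<^sup>2 + e\<^sup>2)"
    by (rule real_le_rsqrt) simp
  then have "s \<le> sqrt (s\<^sup>2 + e\<^sup>2)" "- s \<le> sqrt (s\<^sup>2 + e\<^sup>2)"
    by linarith+
  then show ?thesis
    unfolding smooth_pos_def max_def by simp
qed

lemma smooth_pos_le:
  assumes "e > 0"
  shows "smooth_pos e s \<le> max 0 s + e / 2"
proof -
  have "sqrt (s\<^sup>2 + e\<^sup>2) \<le> \<bar>s\<bar> + e"
    using assms sqrt_sum_squares_le_sum_abs[of s e] by simp
  then show ?thesis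
    unfolding smooth_pos_def by (auto simp: max_def)
qed

lemma DERIV_smooth_pos:
  assumes "e > 0"
  shows "(smooth_pos e has_real_derivative smooth_pos' e s) (at s)"
proof -
  have "s\<^sup>2 + e\<^sup>2 > 0"
    using assms by (simp add: add_nonneg_pos)
  then show ?thesis
    unfolding smooth_pos_def smooth_pos'_def
    by (auto intro!: derivative_eq_intros simp: field_simps)
qed

lemma DERIV_smooth_pos':
  assumes "e > 0"
  shows "(smooth_pos' e has_real_derivative smooth_pos'' e s) (at s)"
proof -
  define r where "r = sqrt (s\<^sup>2 + e\<^sup>2)"
  have pos: "s\<^sup>2 + e\<^sup>2 > 0"
    using assms by (simp add: add_nonneg_pos)
  then have r: "r > 0" "r * r = s\<^sup>2 + e\<^sup>2"
    unfolding r_def by simp_all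
  have dr: "((\<lambda>s. sqrt (s\<^sup>2 + e\<^sup>2)) has_real_derivative s / r) (at s)"
    using pos unfolding r_def by (auto intro!: derivative_eq_intros simp: divide_simps)
  have "((\<lambda>s. s / sqrt (s\<^sup>2 + e\<^sup>2)) has_real_derivative (r - s * (s / r)) / (r * r)) (at s)"
    using DERIV_divide[OF DERIV_ident dr] assms by (simp add: r_def)
  from DERIV_cdivide[OF DERIV_add[OF DERIV_const[of 1] this], of 2]
  have "(smooth_pos' e has_real_derivative (r - s * (s / r)) / (r * r) / 2) (at s)"
    by (simp add: smooth_pos'_def[abs_def])
  moreover have "(r - s * (s / r)) / (r * r) / 2 = e\<^sup>2 / (2 * r ^ 3)"
  proof -
    have "r - s * (s / r) = e\<^sup>2 / r"
      using r by (simp add: field_simps power2_eq_square)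
    then show ?thesis
      by (simp add: power3_eq_cube)
  qed
  ultimately show ?thesis
    unfolding smooth_pos''_def r_def by simp
qed

lemma smooth_pos''_nonneg: "smooth_pos'' e s \<ge> 0"
  unfolding smooth_pos''_def by simp

text \<open>This is why the \<open>L\<^sup>1\<close> norm works: with \<open>r = sqrt (s\<^sup>2 + e\<^sup>2)\<close> the left-hand side is
  \<open>s\<^sup>2 e\<^sup>2 / (2 r\<^sup>3)\<close>, where both \<open>\<bar>s\<bar>\<close> and \<open>e\<close> are at most \<open>r\<close>. Quadratic errors thus vanish with \<open>e\<close>,
  uniformly in \<open>s\<close>.\<close>

lemma smooth_pos''_bound:
  assumes "e > 0"
  shows "s\<^sup>2 * smooth_pos'' e s \<le> e / 2"
proof -
  define r where "r = sqrt (s\<^sup>2 + e\<^sup>2)"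
  have "s\<^sup>2 + e\<^sup>2 > 0"
    using assms by (simp add: add_nonneg_pos)
  then have r: "r > 0" "r\<^sup>2 = s\<^sup>2 + e\<^sup>2"
    unfolding r_def by simp_all
  have "s\<^sup>2 * e \<le> r\<^sup>2 * r"
  proof (rule mult_mono)
    show "e \<le> r"
      unfolding r_def by (rule real_le_rsqrt) simp
  qed (use r assms in auto)
  then have "s\<^sup>2 * e\<^sup>2 \<le> e * r ^ 3"
    using assms by (simp add: power2_eq_square power3_eq_cube mult_ac mult_left_mono)
  then show ?thesis
    using r(1) unfolding smooth_pos''_def r_def[symmetric] by (simp add: field_simps)
qed

lemma continuous_on_smooth_pos [continuous_intros]:
  assumes "continuous_on S f"
  shows "continuous_on S (\<lambda>x. smooth_pos e (f x))"
  unfolding smooth_pos_def by (intro continuous_intros assms) simp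

lemma continuous_on_smooth_pos' [continuous_intros]:
  assumes "e > 0" "continuous_on S f"
  shows "continuous_on S (\<lambda>x. smooth_pos' e (f x))"
proof -
  have "(f x)\<^sup>2 + e\<^sup>2 \<noteq> 0" for x
    using assms(1) by (simp add: sum_power2_eq_zero_iff)
  then show ?thesis
    unfolding smooth_pos'_def by (intro continuous_intros assms) auto
qed

section \<open>Integration by parts over one period\<close>

text \<open>The leading part \<open>p q\<^sup>2 \<ge> c q\<^sup>2\<close> of \<open>q g\<close> has the good sign and dominates the cross term
  \<open>L \<bar>s\<bar> \<bar>q\<bar>\<close>, up to a square of \<open>s\<close>, by completing the square.\<close>

lemma quadratic_absorb:
  fixes c p s q g L :: real
  assumes "c > 0" "c \<le> p" and g: "\<bar>g - p * q\<bar> \<le> L * \<bar>s\<bar>"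
  shows "- (q * g) \<le> L\<^sup>2 / (4 * c) * s\<^sup>2"
proof -
  have "q * g = p * q\<^sup>2 + q * (g - p * q)"
    by (simp add: algebra_simps power2_eq_square)
  moreover have "c * q\<^sup>2 \<le> p * q\<^sup>2"
    using assms(2) by (intro mult_right_mono) auto
  moreover have "\<bar>q * (g - p * q)\<bar> \<le> \<bar>q\<bar> * (L * \<bar>s\<bar>)"
    unfolding abs_mult using g by (intro mult_left_mono) auto
  ultimately have "- (q * g) \<le> \<bar>q\<bar> * (L * \<bar>s\<bar>) - c * q\<^sup>2"
    by linarith
  also have "\<dots> \<le> L\<^sup>2 / (4 * c) * s\<^sup>2"
  proof -
    have "0 \<le> (2 * c * \<bar>q\<bar> - L * \<bar>s\<bar>)\<^sup>2"
      by simp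
    then have "4 * c * (\<bar>q\<bar> * (L * \<bar>s\<bar>) - c * q\<^sup>2) \<le> L\<^sup>2 * s\<^sup>2"
      by (simp add: power2_diff power_mult_distrib algebra_simps power2_eq_square)
    then show ?thesis
      using assms(1) by (simp add: field_simps)
  qed
  finally show ?thesis .
qed

text \<open>The space part of the energy estimate, at a fixed time: \<open>w\<close> is the difference of two solutions,
  \<open>G\<close> the difference of their fluxes, so that \<open>G'\<close> is the time derivative of \<open>w\<close>. By periodicity the
  derivative of \<open>smooth_pos' e \<circ> w \<cdot> G\<close> integrates to \<open>0\<close>, and the term where the first factor is
  differentiated is controlled pointwise by \<open>quadratic_absorb\<close> and \<open>smooth_pos''_bound\<close>.\<close>

lemma integral_smooth_pos'_flux_le:
  fixes w w' G G' p :: "real \<Rightarrow> real"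
  assumes "e > 0" "c > 0"
    and w: "\<And>x. x \<in> {0..1} \<Longrightarrow> (w has_real_derivative w' x) (at x)"
    and G: "\<And>x. x \<in> {0..1} \<Longrightarrow> (G has_real_derivative G' x) (at x)"
    and p: "\<And>x. x \<in> {0..1} \<Longrightarrow> c \<le> p x"
    and flux: "\<And>x. x \<in> {0..1} \<Longrightarrow> \<bar>G x - p x * w' x\<bar> \<le> L * \<bar>w x\<bar>"
    and per: "w 1 = w 0" "G 1 = G 0"
    and int: "(\<lambda>x. smooth_pos' e (w x) * G' x) integrable_on {0..1}"
  shows "integral {0..1} (\<lambda>x. smooth_pos' e (w x) * G' x) \<le> L\<^sup>2 / (8 * c) * e"
proof -
  let ?D = "\<lambda>x. smooth_pos'' e (w x) * w' x * G x + smooth_pos' e (w x) * G' x"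
  have "(?D has_integral smooth_pos' e (w 1) * G 1 - smooth_pos' e (w 0) * G 0) {0..1}"
  proof (rule fundamental_theorem_of_calculus)
    fix x :: real assume x: "x \<in> {0..1}"
    have "((\<lambda>x. smooth_pos' e (w x)) has_real_derivative smooth_pos'' e (w x) * w' x) (at x)"
      by (rule DERIV_chain2[OF DERIV_smooth_pos'[OF assms(1)] w[OF x]])
    from DERIV_mult[OF this G[OF x]]
    have "((\<lambda>x. smooth_pos' e (w x) * G x) has_real_derivative ?D x) (at x)"
      by (simp add: algebra_simps)
    then show "((\<lambda>x. smooth_pos' e (w x) * G x) has_vector_derivative ?D x) (at x within {0..1})"
      by (simp add: has_real_derivative_iff_has_vector_derivative has_vector_derivative_at_within)
  qed simp
  then have D: "(?D has_integral 0) {0..1}"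
    by (simp add: per)
  have "((\<lambda>x. ?D x + L\<^sup>2 / (8 * c) * e) has_integral 0 + L\<^sup>2 / (8 * c) * e) {0..1}"
    using has_integral_add[OF D has_integral_const_real[of "L\<^sup>2 / (8 * c) * e" 0 1]] by simp
  moreover have "smooth_pos' e (w x) * G' x \<le> ?D x + L\<^sup>2 / (8 * c) * e" if x: "x \<in> {0..1}" for x
  proof -
    have "smooth_pos'' e (w x) * (- (w' x * G x)) \<le> smooth_pos'' e (w x) * (L\<^sup>2 / (4 * c) * (w x)\<^sup>2)"
      by (intro mult_left_mono quadratic_absorb[OF assms(2) p[OF x] flux[OF x]] smooth_pos''_nonneg)
    also have "\<dots> = L\<^sup>2 / (4 * c) * ((w x)\<^sup>2 * smooth_pos'' e (w x))"
      by simp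
    also have "\<dots> \<le> L\<^sup>2 / (4 * c) * (e / 2)"
      using assms(2) by (intro mult_left_mono smooth_pos''_bound[OF assms(1)]) auto
    finally show ?thesis
      by (simp add: algebra_simps)
  qed
  ultimately show ?thesis
    using has_integral_le[OF integrable_integral[OF int]] by auto
qed

section \<open>Regularity\<close>

lemma C_k_1_iff:
  "C_k 1 f \<longleftrightarrow> (\<forall>x. (f has_real_derivative deriv f x) (at x)) \<and> continuous_on UNIV (deriv f)"
  unfolding C_k_def by (auto simp: DERIV_deriv_iff_field_differentiable)

lemma C_k_2_imp:
  assumes "C_k 2 f"
  shows "C_k 1 f" "C_k 1 (deriv f)"
proof -
  have "\<forall>x. f field_differentiable at x" "\<forall>x. deriv f field_differentiable at x"
    "continuous_on UNIV (deriv (deriv f))"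
    using assms unfolding C_k_def by (auto simp: numeral_2_eq_2 less_Suc_eq)
  moreover from this(2) have "continuous_on UNIV (deriv f)"
    by (auto intro!: continuous_at_imp_continuous_on field_differentiable_imp_continuous_at)
  ultimately show "C_k 1 f" "C_k 1 (deriv f)"
    by (auto simp: C_k_def)
qed

lemma continuous_on_compact_bound:
  fixes f :: "'a::topological_space \<Rightarrow> real"
  assumes "compact S" "continuous_on S f"
  obtains B where "B \<ge> 0" "\<And>x. x \<in> S \<Longrightarrow> \<bar>f x\<bar> \<le> B"
proof -
  have "bounded (f ` S)"
    using assms by (intro compact_imp_bounded compact_continuous_image)
  then obtain B where "\<forall>y\<in>f ` S. norm y \<le> B"
    unfolding bounded_iff by blast
  then show ?thesis
    using that[of "max B 0"] by fastforce
qed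

lemma C_k_1_Lipschitz_on_interval:
  fixes f :: "real \<Rightarrow> real"
  assumes "C_k 1 f"
  obtains L where "L \<ge> 0"
    "\<And>a b. \<bar>a\<bar> \<le> R \<Longrightarrow> \<bar>b\<bar> \<le> R \<Longrightarrow> \<bar>f a - f b\<bar> \<le> L * \<bar>a - b\<bar>"
proof -
  have df: "(f has_real_derivative deriv f x) (at x)" and cf: "continuous_on {-R..R} (deriv f)" for x
    using assms unfolding C_k_1_iff by (auto intro: continuous_on_subset)
  obtain L where L: "L \<ge> 0" "\<And>x. x \<in> {-R..R} \<Longrightarrow> \<bar>deriv f x\<bar> \<le> L"
    using continuous_on_compact_bound[OF compact_Icc cf] by blast
  have "\<bar>f a - f b\<bar> \<le> L * \<bar>a - b\<bar>" if "\<bar>a\<bar> \<le> R" "\<bar>b\<bar> \<le> R" for a b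
    using field_differentiable_bound[of "{-R..R}" f "deriv f" L a b] df L that
    by (auto intro: has_field_derivative_at_within simp: abs_le_iff)
  then show ?thesis
    using that L(1) by blast
qed

lemma periodic_deriv:
  fixes f :: "real \<Rightarrow> real"
  assumes "periodic_fun_simple' f"
  shows "deriv f (x + 1) = deriv f x"
proof -
  have "(f has_real_derivative D) (at (x + 1)) \<longleftrightarrow> (f has_real_derivative D) (at x)" for D
    using DERIV_shift[of f D x 1] periodic_fun_simple'.plus_period[OF assms] by simp
  then show ?thesis
    unfolding deriv_def by simp
qed

lemma periodic_eq_on_unit_interval:
  fixes f :: "real \<Rightarrow> 'a"
  assumes "periodic_fun_simple' f"
  shows "f x = f (frac x)"
proof -
  interpret periodic_fun_simple' f by fact
  show ?thesis
    using minus_of_int[of x "\<lfloor>x\<rfloor>"] by (simp add: frac_def)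
qed

lemma classical_regularityD:
  assumes "classical_regularity v"
  shows "t \<ge> 0 \<Longrightarrow> periodic_fun_simple' (v t)"
    and "continuous_on ({0..} \<times> UNIV) (\<lambda>(t, x). v t x)"
    and "t > 0 \<Longrightarrow> ((\<lambda>s. v s x) has_real_derivative d_t v t x) (at t)"
    and "t > 0 \<Longrightarrow> (v t has_real_derivative deriv (v t) x) (at x)"
    and "t > 0 \<Longrightarrow> (deriv (v t) has_real_derivative deriv (deriv (v t)) x) (at x)"
    and "continuous_on ({0<..} \<times> UNIV) (\<lambda>(t, x). d_t v t x)"
    and "continuous_on ({0<..} \<times> UNIV) (\<lambda>(t, x). deriv (v t) x)"
  using assms
  by (auto simp: classical_regularity_def grad_def d_t_def DERIV_deriv_iff_field_differentiable)

section \<open>The flux\<close>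

definition flux ::
  "(real \<Rightarrow> real) \<Rightarrow> (real \<Rightarrow> real) \<Rightarrow> (real \<Rightarrow> real) \<Rightarrow> (real \<Rightarrow> real) \<Rightarrow> real \<Rightarrow> real" where
  "flux \<phi> chi \<xi> f x = deriv \<phi> (f x) * deriv f x + chi (f x) * \<xi> x"

locale torus_equation =
  fixes \<phi> chi \<xi> :: "real \<Rightarrow> real" and c :: real
  assumes phi_C2: "C_k 2 \<phi>"
    and c_pos: "c > 0" and phi_deriv: "\<And>u. deriv \<phi> u \<ge> c"
    and xi_C1: "C_k 1 \<xi>" and xi_periodic: "periodic_fun_simple' \<xi>"
    and chi_C1: "C_k 1 chi"
begin

text \<open>The equation only asserts an identity between values of \<open>deriv\<close>, which are meaningful only for
  differentiable functions; both parts of the flux are differentiable because \<open>\<phi>\<close> is \<open>C\<^sup>2\<close>, \<open>chi\<close> and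
  \<open>\<xi>\<close> are \<open>C\<^sup>1\<close>, and \<open>v\<close> is twice differentiable in space.\<close>

lemma DERIV_flux:
  assumes "is_solution \<phi> chi \<xi> v" "t > 0"
  shows "(flux \<phi> chi \<xi> (v t) has_real_derivative d_t v t x) (at x)"
proof -
  have reg: "classical_regularity v"
    and eq: "d_t v t x = laplace (\<lambda>y. \<phi> (v t y)) x + grad (\<lambda>y. chi (v t y) * \<xi> y) x"
    using assms unfolding is_solution_def by auto
  note dv = classical_regularityD(4)[OF reg assms(2)]
  note d2v = classical_regularityD(5)[OF reg assms(2)]
  have dphi: "(\<phi> has_real_derivative deriv \<phi> u) (at u)"
    and d2phi: "(deriv \<phi> has_real_derivative deriv (deriv \<phi>) u) (at u)"
    and dchi: "(chi has_real_derivative deriv chi u) (at u)"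
    and dxi: "(\<xi> has_real_derivative deriv \<xi> u) (at u)" for u
    using C_k_2_imp[OF phi_C2] chi_C1 xi_C1 unfolding C_k_1_iff by blast+
  have 1: "deriv (\<lambda>y. \<phi> (v t y)) = (\<lambda>y. deriv \<phi> (v t y) * deriv (v t) y)"
    by (rule ext, rule DERIV_imp_deriv) (rule DERIV_chain2[OF dphi dv])
  have diffusion: "((\<lambda>y. deriv \<phi> (v t y) * deriv (v t) y) has_real_derivative
      laplace (\<lambda>y. \<phi> (v t y)) x) (at x)"
  proof -
    have "(\<lambda>y. deriv \<phi> (v t y) * deriv (v t) y) field_differentiable at x"
      using DERIV_mult[OF DERIV_chain2[OF d2phi dv] d2v] unfolding field_differentiable_def by blast
    then show ?thesis
      by (simp add: laplace_def 1 DERIV_deriv_iff_field_differentiable)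
  qed
  have transport: "((\<lambda>y. chi (v t y) * \<xi> y) has_real_derivative grad (\<lambda>y. chi (v t y) * \<xi> y) x) (at x)"
  proof -
    have "(\<lambda>y. chi (v t y) * \<xi> y) field_differentiable at x"
      using DERIV_mult[OF DERIV_chain2[OF dchi dv] dxi] unfolding field_differentiable_def by blast
    then show ?thesis
      by (simp add: grad_def DERIV_deriv_iff_field_differentiable)
  qed
  show ?thesis
    unfolding eq flux_def[abs_def] by (rule DERIV_add[OF diffusion transport])
qed

lemma flux_periodic:
  assumes "periodic_fun_simple' f"
  shows "flux \<phi> chi \<xi> f 1 = flux \<phi> chi \<xi> f 0"
  using periodic_deriv[OF assms, of 0] periodic_fun_simple'.plus_period[OF assms, of 0]
    periodic_fun_simple'.plus_period[OF xi_periodic, of 0]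
  by (simp add: flux_def)

text \<open>Subtracting \<open>\<phi>'(v\<^sub>2) \<partial>\<^sub>x(v\<^sub>2 - v\<^sub>1)\<close> leaves
  \<open>(\<phi>'(v\<^sub>2) - \<phi>'(v\<^sub>1)) \<partial>\<^sub>x v\<^sub>1 + (chi(v\<^sub>2) - chi(v\<^sub>1)) \<xi>\<close>. On the compact set \<open>[\<tau>,T] \<times> [0,1]\<close> the values
  of both solutions lie in a bounded interval, on which \<open>\<phi>'\<close> and \<open>chi\<close> are Lipschitz, and \<open>\<partial>\<^sub>x v\<^sub>1\<close> is
  bounded; the latter requires \<open>\<tau> > 0\<close>.\<close>

lemma flux_difference_bound:
  assumes reg: "classical_regularity v1" "classical_regularity v2" and "0 < \<tau>"
  obtains L where
    "\<And>t x. t \<in> {\<tau>..T} \<Longrightarrow> x \<in> {0..1} \<Longrightarrow>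
      \<bar>flux \<phi> chi \<xi> (v2 t) x - flux \<phi> chi \<xi> (v1 t) x
        - deriv \<phi> (v2 t x) * (deriv (v2 t) x - deriv (v1 t) x)\<bar>
      \<le> L * \<bar>v2 t x - v1 t x\<bar>"
proof -
  let ?S = "{\<tau>..T} \<times> {0..1::real}"
  have S: "compact ?S" "?S \<subseteq> {0..} \<times> UNIV" "?S \<subseteq> {0<..} \<times> UNIV"
    using assms(3) by (auto intro!: compact_Times)
  obtain R1 where R1: "\<And>z. z \<in> ?S \<Longrightarrow> \<bar>(\<lambda>(t, x). v1 t x) z\<bar> \<le> R1"
    using continuous_on_compact_bound[OF S(1)
        continuous_on_subset[OF classical_regularityD(2)[OF reg(1)] S(2)]] by blast
  obtain R2 where R2: "\<And>z. z \<in> ?S \<Longrightarrow> \<bar>(\<lambda>(t, x). v2 t x) z\<bar> \<le> R2"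
    using continuous_on_compact_bound[OF S(1)
        continuous_on_subset[OF classical_regularityD(2)[OF reg(2)] S(2)]] by blast
  obtain P where P: "P \<ge> 0" "\<And>z. z \<in> ?S \<Longrightarrow> \<bar>(\<lambda>(t, x). deriv (v1 t) x) z\<bar> \<le> P"
    using continuous_on_compact_bound[OF S(1)
        continuous_on_subset[OF classical_regularityD(7)[OF reg(1)] S(3)]] by blast
  have "continuous_on {0..1} \<xi>"
    using xi_C1 unfolding C_k_1_iff
    by (auto intro!: continuous_at_imp_continuous_on DERIV_isCont)
  then obtain X where X: "X \<ge> 0" "\<And>x. x \<in> {0..1} \<Longrightarrow> \<bar>\<xi> x\<bar> \<le> X"
    using continuous_on_compact_bound[OF compact_Icc] by blast
  define R where "R = max R1 R2"
  obtain A where A: "A \<ge> 0"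
    "\<And>a b. \<bar>a\<bar> \<le> R \<Longrightarrow> \<bar>b\<bar> \<le> R \<Longrightarrow> \<bar>deriv \<phi> a - deriv \<phi> b\<bar> \<le> A * \<bar>a - b\<bar>"
    using C_k_1_Lipschitz_on_interval[OF C_k_2_imp(2)[OF phi_C2]] by blast
  obtain B where B: "B \<ge> 0"
    "\<And>a b. \<bar>a\<bar> \<le> R \<Longrightarrow> \<bar>b\<bar> \<le> R \<Longrightarrow> \<bar>chi a - chi b\<bar> \<le> B * \<bar>a - b\<bar>"
    using C_k_1_Lipschitz_on_interval[OF chi_C1] by blast
  have "\<bar>flux \<phi> chi \<xi> (v2 t) x - flux \<phi> chi \<xi> (v1 t) x
        - deriv \<phi> (v2 t x) * (deriv (v2 t) x - deriv (v1 t) x)\<bar>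
      \<le> (A * P + B * X) * \<bar>v2 t x - v1 t x\<bar>" if tx: "t \<in> {\<tau>..T}" "x \<in> {0..1}" for t x
  proof -
    have z: "(t, x) \<in> ?S"
      using tx by simp
    have R: "\<bar>v2 t x\<bar> \<le> R" "\<bar>v1 t x\<bar> \<le> R"
      using R1[OF z] R2[OF z] by (auto simp: R_def)
    have "\<bar>(deriv \<phi> (v2 t x) - deriv \<phi> (v1 t x)) * deriv (v1 t) x\<bar> \<le> A * \<bar>v2 t x - v1 t x\<bar> * P"
      unfolding abs_mult using A(1) A(2)[OF R] P(2)[OF z] by (intro mult_mono) auto
    moreover have "\<bar>(chi (v2 t x) - chi (v1 t x)) * \<xi> x\<bar> \<le> B * \<bar>v2 t x - v1 t x\<bar> * X"
      unfolding abs_mult using B(1) B(2)[OF R] X(2)[OF tx(2)] by (intro mult_mono) auto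
    moreover have "flux \<phi> chi \<xi> (v2 t) x - flux \<phi> chi \<xi> (v1 t) x
        - deriv \<phi> (v2 t x) * (deriv (v2 t) x - deriv (v1 t) x)
      = (deriv \<phi> (v2 t x) - deriv \<phi> (v1 t x)) * deriv (v1 t) x
        + (chi (v2 t x) - chi (v1 t x)) * \<xi> x"
      by (simp add: flux_def algebra_simps)
    ultimately have "\<bar>flux \<phi> chi \<xi> (v2 t) x - flux \<phi> chi \<xi> (v1 t) x
        - deriv \<phi> (v2 t x) * (deriv (v2 t) x - deriv (v1 t) x)\<bar>
      \<le> A * \<bar>v2 t x - v1 t x\<bar> * P + B * \<bar>v2 t x - v1 t x\<bar> * X"
      by linarith
    also have "\<dots> = (A * P + B * X) * \<bar>v2 t x - v1 t x\<bar>"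
      by (simp add: algebra_simps)
    finally show ?thesis .
  qed
  then show ?thesis
    using that by blast
qed

section \<open>Contraction and comparison\<close>

text \<open>The essential point is that \<open>K\<close>, which depends on \<open>\<tau>\<close>, \<open>T\<close> and the two solutions, does not depend
  on \<open>e\<close>.\<close>

lemma smooth_pos_almost_decreasing:
  assumes sol: "is_solution \<phi> chi \<xi> v1" "is_solution \<phi> chi \<xi> v2"
    and "0 < \<tau>" "\<tau> \<le> T"
  obtains K where
    "\<And>e. e > 0 \<Longrightarrow> integral {0..1} (\<lambda>x. smooth_pos e (v2 T x - v1 T x))
      \<le> integral {0..1} (\<lambda>x. smooth_pos e (v2 \<tau> x - v1 \<tau> x)) + K * e"
proof -
  have reg: "classical_regularity v1" "classical_regularity v2"
    using sol unfolding is_solution_def by auto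
  obtain L where L: "\<And>t x. t \<in> {\<tau>..T} \<Longrightarrow> x \<in> {0..1} \<Longrightarrow>
      \<bar>flux \<phi> chi \<xi> (v2 t) x - flux \<phi> chi \<xi> (v1 t) x
        - deriv \<phi> (v2 t x) * (deriv (v2 t) x - deriv (v1 t) x)\<bar>
      \<le> L * \<bar>v2 t x - v1 t x\<bar>"
    using flux_difference_bound[OF reg assms(3)] by blast
  define M where "M = L\<^sup>2 / (8 * c)"
  have "integral {0..1} (\<lambda>x. smooth_pos e (v2 T x - v1 T x))
      \<le> integral {0..1} (\<lambda>x. smooth_pos e (v2 \<tau> x - v1 \<tau> x)) + M * (T - \<tau>) * e"
    if e: "e > 0" for e
  proof -
    define E where "E = (\<lambda>t. integral {0..1} (\<lambda>x. smooth_pos e (v2 t x - v1 t x)))"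
    let ?f = "\<lambda>t x. smooth_pos' e (v2 t x - v1 t x) * (d_t v2 t x - d_t v1 t x)"
    have sub: "{0<..} \<times> {0..1} \<subseteq> {0::real..} \<times> (UNIV :: real set)"
      "{0<..} \<times> {0..1} \<subseteq> {0::real<..} \<times> (UNIV :: real set)"
      by auto
    have w: "continuous_on ({0<..} \<times> {0..1}) (\<lambda>(t, x). v2 t x - v1 t x)"
      using continuous_on_diff[OF continuous_on_subset[OF classical_regularityD(2)[OF reg(2)] sub(1)]
          continuous_on_subset[OF classical_regularityD(2)[OF reg(1)] sub(1)]]
      by (simp add: case_prod_beta)
    have dw: "continuous_on ({0<..} \<times> {0..1}) (\<lambda>(t, x). d_t v2 t x - d_t v1 t x)"
      using continuous_on_diff[OF continuous_on_subset[OF classical_regularityD(6)[OF reg(2)] sub(2)]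
          continuous_on_subset[OF classical_regularityD(6)[OF reg(1)] sub(2)]]
      by (simp add: case_prod_beta)
    have cf: "continuous_on ({0<..} \<times> {0..1}) (\<lambda>(t, x). ?f t x)"
      using continuous_on_mult[OF continuous_on_smooth_pos'[OF e w] dw]
      by (simp add: case_prod_beta)
    have slice: "continuous_on {0..1} (g t)"
      if "continuous_on ({0<..} \<times> {0..1}) (\<lambda>(t, x). g t x)" "t > 0" for g :: "real \<Rightarrow> real \<Rightarrow> real" and t
      using continuous_on_compose2[OF that(1) continuous_on_Pair[OF continuous_on_const[of _ t] continuous_on_id], of "{0..1}"] that(2)
      by auto
    have dE: "(E has_real_derivative integral {0..1} (?f t)) (at t)" if t: "t > 0" for t
    proof -
      have "((\<lambda>t. integral (cbox 0 1) (\<lambda>x. smooth_pos e (v2 t x - v1 t x)))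
          has_field_derivative integral (cbox 0 1) (?f t)) (at t within {0<..})"
      proof (rule leibniz_rule_field_derivative)
        fix s x :: real assume "s \<in> {0<..}"
        then have "((\<lambda>s. v2 s x - v1 s x) has_real_derivative d_t v2 s x - d_t v1 s x) (at s)"
          using classical_regularityD(3)[OF reg(1)] classical_regularityD(3)[OF reg(2)]
          by (intro DERIV_diff) auto
        from DERIV_chain2[OF DERIV_smooth_pos[OF e] this]
        show "((\<lambda>s. smooth_pos e (v2 s x - v1 s x)) has_real_derivative ?f s x) (at s within {0<..})"
          by (rule has_field_derivative_at_within)
      next
        fix s :: real assume "s \<in> {0<..}"
        then show "(\<lambda>x. smooth_pos e (v2 s x - v1 s x)) integrable_on cbox 0 1"
          using slice[OF w, of s] by (auto intro!: integrable_continuous_interval continuous_intros)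
      qed (use cf t in auto)
      then show ?thesis
        using t by (simp add: E_def at_within_open[of t "{0<..}"])
    qed
    have le: "integral {0..1} (?f t) \<le> M * e" if t: "t \<in> {\<tau>..T}" for t
    proof -
      have t0: "t > 0"
        using t assms(3) by auto
      note per = classical_regularityD(1)[OF reg(1), of t] classical_regularityD(1)[OF reg(2), of t]
      show ?thesis
        unfolding M_def
      proof (rule integral_smooth_pos'_flux_le[OF e c_pos])
        fix x :: real
        show "((\<lambda>x. v2 t x - v1 t x) has_real_derivative deriv (v2 t) x - deriv (v1 t) x) (at x)"
          by (intro DERIV_diff classical_regularityD(4) reg t0)
        show "((\<lambda>x. flux \<phi> chi \<xi> (v2 t) x - flux \<phi> chi \<xi> (v1 t) x)
            has_real_derivative d_t v2 t x - d_t v1 t x) (at x)"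
          by (intro DERIV_diff DERIV_flux sol t0)
        show "c \<le> deriv \<phi> (v2 t x)"
          by (rule phi_deriv)
      next
        show "v2 t 1 - v1 t 1 = v2 t 0 - v1 t 0"
          using periodic_fun_simple'.of_1[OF per(1)] periodic_fun_simple'.of_1[OF per(2)] t0 by simp
        show "flux \<phi> chi \<xi> (v2 t) 1 - flux \<phi> chi \<xi> (v1 t) 1
            = flux \<phi> chi \<xi> (v2 t) 0 - flux \<phi> chi \<xi> (v1 t) 0"
          using per t0 by (simp add: flux_periodic)
        show "?f t integrable_on {0..1}"
          by (rule integrable_continuous_interval) (rule slice[OF cf t0])
      qed (use L[OF t] in auto)
    qed
    have "E T - M * e * T \<le> E \<tau> - M * e * \<tau>"
    proof (rule DERIV_nonpos_imp_nonincreasing[OF assms(4)])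
      fix t assume t: "\<tau> \<le> t" "t \<le> T"
      have "((\<lambda>t. E t - M * e * t) has_real_derivative integral {0..1} (?f t) - M * e) (at t)"
        using dE[of t] t assms(3) by (auto intro!: derivative_eq_intros)
      then show "\<exists>y. ((\<lambda>t. E t - M * e * t) has_real_derivative y) (at t) \<and> y \<le> 0"
        using le[of t] t by auto
    qed
    then show ?thesis
      by (simp add: E_def algebra_simps)
  qed
  then show ?thesis
    using that by blast
qed

lemma integral_positive_part_le:
  assumes sol: "is_solution \<phi> chi \<xi> v1" "is_solution \<phi> chi \<xi> v2"
    and "0 < \<tau>" "\<tau> \<le> T"
  shows "integral {0..1} (\<lambda>x. max 0 (v2 T x - v1 T x))
    \<le> integral {0..1} (\<lambda>x. max 0 (v2 \<tau> x - v1 \<tau> x))"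
proof -
  have reg: "classical_regularity v1" "classical_regularity v2"
    using sol unfolding is_solution_def by auto
  have cont: "continuous_on {0..1} (v1 t)" "continuous_on {0..1} (v2 t)" if "t > 0" for t
    using classical_regularityD(4)[OF reg(1) that] classical_regularityD(4)[OF reg(2) that]
    by (auto intro!: continuous_at_imp_continuous_on DERIV_isCont)
  obtain K where K: "\<And>e. e > 0 \<Longrightarrow> integral {0..1} (\<lambda>x. smooth_pos e (v2 T x - v1 T x))
      \<le> integral {0..1} (\<lambda>x. smooth_pos e (v2 \<tau> x - v1 \<tau> x)) + K * e"
    using smooth_pos_almost_decreasing[OF assms] by blast
  let ?I = "\<lambda>t. integral {0..1} (\<lambda>x. max 0 (v2 t x - v1 t x))"
  have le: "?I T \<le> ?I \<tau> + (K + 1 / 2) * e" if e: "e > 0" for e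
  proof -
    have "?I T \<le> integral {0..1} (\<lambda>x. smooth_pos e (v2 T x - v1 T x))"
      using assms(3,4) by (intro integral_le smooth_pos_ge)
        (auto intro!: integrable_continuous_interval continuous_intros cont)
    also have "\<dots> \<le> integral {0..1} (\<lambda>x. smooth_pos e (v2 \<tau> x - v1 \<tau> x)) + K * e"
      by (rule K[OF e])
    also have "integral {0..1} (\<lambda>x. smooth_pos e (v2 \<tau> x - v1 \<tau> x))
        \<le> integral {0..1} (\<lambda>x. max 0 (v2 \<tau> x - v1 \<tau> x) + e / 2)"
      using assms(3) e by (intro integral_le smooth_pos_le)
        (auto intro!: integrable_continuous_interval continuous_intros cont)
    also have "\<dots> = ?I \<tau> + e / 2"
      using assms(3) by (subst integral_add)
        (auto intro!: integrable_continuous_interval continuous_intros cont)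
    finally show ?thesis
      by (simp add: algebra_simps)
  qed
  have "((\<lambda>e. ?I \<tau> + (K + 1 / 2) * e) \<longlongrightarrow> ?I \<tau> + (K + 1 / 2) * 0) (at_right 0)"
    by (intro tendsto_intros)
  moreover have "\<forall>\<^sub>F e in at_right 0. ?I T \<le> ?I \<tau> + (K + 1 / 2) * e"
    using eventually_at_right_less[of "0::real"] by eventually_elim (rule le)
  ultimately show ?thesis
    using tendsto_lowerbound[of _ _ "at_right (0::real)"] by fastforce
qed

text \<open>The contraction holds from every positive time \<open>\<tau>\<close> on, and the integral at time \<open>\<tau>\<close> tends to its
  value \<open>0\<close> at the initial time by joint continuity. A continuous nonnegative function with integral
  \<open>0\<close> vanishes.\<close>

lemma comparison:
  assumes sol: "is_solution \<phi> chi \<xi> v1" "is_solution \<phi> chi \<xi> v2"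
    and init: "\<And>x. v2 0 x \<le> v1 0 x" and "T \<ge> 0"
  shows "v2 T x \<le> v1 T x"
proof (cases "T = 0")
  case False
  then have T: "T > 0"
    using assms(4) by simp
  have reg: "classical_regularity v1" "classical_regularity v2"
    using sol unfolding is_solution_def by auto
  let ?g = "\<lambda>t x. max 0 (v2 t x - v1 t x)"
  have sub: "cbox 0 T \<times> {0..1} \<subseteq> {0..} \<times> (UNIV :: real set)"
    by auto
  have cont2: "continuous_on (cbox 0 T \<times> cbox 0 1) (\<lambda>(t, x). ?g t x)"
    using continuous_on_max[OF continuous_on_const[of _ 0]
        continuous_on_diff[OF continuous_on_subset[OF classical_regularityD(2)[OF reg(2)] sub]
          continuous_on_subset[OF classical_regularityD(2)[OF reg(1)] sub]]]
    by (simp add: case_prod_beta)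
  have cont: "continuous_on {0..1} (?g T)"
    using continuous_on_compose2[OF cont2 continuous_on_Pair[OF continuous_on_const[of _ T] continuous_on_id], of "{0..1}"] T
    by (auto simp: image_subset_iff)
  have "continuous_on {0..T} (\<lambda>t. integral {0..1} (?g t))"
    using integral_continuous_on_param[OF cont2] by simp
  then have "((\<lambda>t. integral {0..1} (?g t)) \<longlongrightarrow> integral {0..1} (?g 0)) (at_right 0)"
    using T continuous_on_Icc_at_rightD by blast
  moreover have "integral {0..1} (?g 0) = 0"
    using init by (simp add: max_absorb1)
  moreover have "\<forall>\<^sub>F t in at_right 0. integral {0..1} (?g T) \<le> integral {0..1} (?g t)"
    using eventually_at_right_less[of "0::real"] eventually_at_right_real[OF T]
    by eventually_elim (auto intro: integral_positive_part_le[OF sol])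
  ultimately have "integral {0..1} (?g T) \<le> 0"
    using tendsto_lowerbound[of _ _ "at_right (0::real)"] by fastforce
  moreover have "integral {0..1} (?g T) \<ge> 0"
    by (intro integral_nonneg integrable_continuous_interval cont) auto
  ultimately have "integral {0..1} (?g T) = 0"
    by simp
  then have "\<forall>y\<in>{0..1}. ?g T y = 0"
    using integral_eq_0_iff[OF cont] by simp
  then have "?g T (frac x) = 0"
    by (simp add: frac_lt_1 less_imp_le)
  then show ?thesis
    using periodic_eq_on_unit_interval[OF classical_regularityD(1)[OF reg(1) assms(4)], of x]
      periodic_eq_on_unit_interval[OF classical_regularityD(1)[OF reg(2) assms(4)], of x]
    by (simp add: max_def split: if_splits)
qed (use init in simp)

end

lemma is_solution_zero:
  assumes "chi 0 = 0"
  shows "is_solution \<phi> chi \<xi> (\<lambda>t x. 0)"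
  using assms
  by (auto simp: is_solution_def classical_regularity_def periodic_fun_simple'_def
      d_t_def grad_def laplace_def)

theorem lemma6p1:
  fixes \<phi> chi \<xi> :: "real \<Rightarrow> real" and c C :: real
  assumes phi_C2: "C_k 2 \<phi>"
    and c_pos: "c > 0" and phi_deriv: "\<And>u. deriv \<phi> u \<ge> c"
    and xi_smooth: "smooth_torus \<xi>"
    and chi_C1: "C_k 1 chi"
    and C_pos: "C > 0" and chi_deriv: "\<And>u. \<bar>deriv chi u\<bar> \<le> C * deriv \<phi> u"
  shows "(\<forall>v1 v2. is_solution \<phi> chi \<xi> v1 \<longrightarrow> is_solution \<phi> chi \<xi> v2 \<longrightarrow>
            (\<forall>x. v1 0 x \<ge> v2 0 x) \<longrightarrow> (\<forall>t\<ge>0. \<forall>x. v1 t x \<ge> v2 t x)) \<and>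
         (chi 0 = 0 \<longrightarrow>
            (\<forall>v. is_solution \<phi> chi \<xi> v \<longrightarrow>
              (\<forall>x. v 0 x \<ge> 0) \<longrightarrow> (\<forall>t\<ge>0. \<forall>x. v t x \<ge> 0)))"
proof -
  interpret torus_equation \<phi> chi \<xi> c
    using phi_C2 c_pos phi_deriv xi_smooth chi_C1
    unfolding smooth_torus_def by (intro torus_equation.intro) auto
  show ?thesis
    using comparison is_solution_zero[of chi \<phi> \<xi>] by blast
qed

end
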